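(* Let $(V,\mathcal I,\mathcal D,f)$ be a weighted configuration with $V\ne\emptyset$, and for $x\in\mathcal I$ let $H(x)(t)=\sum_{y\in\mathcal I,\ x\subseteq y}(-1)^{|y|-|x|}t^{|y|}f(y)$. Then $(V,\mathcal I,\mathcal D,f)$ is of type I if and only if there exists a real $t>0$ such that $H(\emptyset)(t)=0$ and $H(x)(t)\geq0$ for all $x\in\mathcal I$. If such a $t$ exists, it is unique and equals the critical root $t_0$.
   Context: A configuration is a triple $(V,\mathcal I,\mathcal D)$ with $V$ finite, $\mathcal I\subseteq\mathcal P(V)$ non empty, downward closed under inclusion, containing all singletons, and $\mathcal D=\mathcal P(V)\setminus\mathcal I$. For $x,y\in\mathcal I$, $x\parallel y$ means $x\cap y=\emptyset$ and $x\cup y\in\mathcal I$. A valuation is $f:\mathcal I\to\mathbb R_{>0}$ with $f(\emptyset)=1$ and $f(x\cup y)=f(x)f(y)$ whenever $x\parallel y$. A weighted configuration is $(V,\mathcal I,\mathcal D,f)$. Its critical root is $t_0=\min\{t\ge0 : \exists x\in\mathcal I,\ H(x)(t)=0\}$ (a positive real when $V\ne\emptyset$). The weighted configuration is of type I if $H(\emptyset)(t_0)=0$, and of type II if $H(\emptyset)(t_0)>0$.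
   Formalization: The critical root is taken as the least t > 0 (not t ≥ 0) at which some H(x) vanishes; with t ≥ 0 every H(x), x nonempty, vanishes at 0, so the root would be 0, no configuration would be of type I, and the claim would be false. *)

theory Defs
  imports Complex_Main
begin

definition configuration :: "'a set \<Rightarrow> 'a set set \<Rightarrow> 'a set set \<Rightarrow> bool" where
  "configuration V \<I> \<D> \<longleftrightarrow>
     finite V \<and> \<I> \<subseteq> Pow V \<and> \<I> \<noteq> {} \<and>
     (\<forall>y\<in>\<I>. \<forall>x. x \<subseteq> y \<longrightarrow> x \<in> \<I>) \<and>
     (\<forall>v\<in>V. {v} \<in> \<I>) \<and>
     \<D> = Pow V - \<I>"

definition parallel :: "'a set set \<Rightarrow> 'a set \<Rightarrow> 'a set \<Rightarrow> bool" where
  "parallel \<I> x y \<longleftrightarrow> x \<inter> y = {} \<and> x \<union> y \<in> \<I>"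

text \<open>A valuation is only meaningful on \<open>\<I>\<close>; its values outside \<open>\<I>\<close> are unconstrained and never used.\<close>

definition valuation :: "'a set set \<Rightarrow> ('a set \<Rightarrow> real) \<Rightarrow> bool" where
  "valuation \<I> f \<longleftrightarrow>
     (\<forall>x\<in>\<I>. f x > 0) \<and> f {} = 1 \<and>
     (\<forall>x\<in>\<I>. \<forall>y\<in>\<I>. parallel \<I> x y \<longrightarrow> f (x \<union> y) = f x * f y)"

definition weighted_configuration ::
    "'a set \<Rightarrow> 'a set set \<Rightarrow> 'a set set \<Rightarrow> ('a set \<Rightarrow> real) \<Rightarrow> bool" where
  "weighted_configuration V \<I> \<D> f \<longleftrightarrow> configuration V \<I> \<D> \<and> valuation \<I> f"

definition H :: "'a set set \<Rightarrow> ('a set \<Rightarrow> real) \<Rightarrow> 'a set \<Rightarrow> real \<Rightarrow> real" where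
  "H \<I> f x t = (\<Sum>y\<in>{y\<in>\<I>. x \<subseteq> y}. (- 1) ^ (card y - card x) * t ^ card y * f y)"

text \<open>
  The minimum is over positive \<open>t\<close>: every \<open>H \<I> f x\<close> with \<open>x\<close> nonempty has the factor
  \<open>t ^ card x\<close> and hence a spurious zero at \<open>0\<close>, whereas the critical root is meant to be
  positive for nonempty \<open>V\<close>.
\<close>

definition critical_root :: "'a set set \<Rightarrow> ('a set \<Rightarrow> real) \<Rightarrow> real" where
  "critical_root \<I> f = (LEAST t. 0 < t \<and> (\<exists>x\<in>\<I>. H \<I> f x t = 0))"

definition type_I :: "'a set set \<Rightarrow> ('a set \<Rightarrow> real) \<Rightarrow> bool" where
  "type_I \<I> f \<longleftrightarrow> H \<I> f {} (critical_root \<I> f) = 0"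

end

theory Submission
  imports Defs
begin

text \<open>
  The Moebius transform \<open>H\<close> satisfies a thinning identity: for all real \<open>r\<close> and \<open>t\<close>,
  \<open>H(x)(r t)\<close> is the sum of \<open>r ^ card x * (1 - r) ^ (card y - card x) * H(y)(t)\<close>
  over the faces \<open>y\<close> containing \<open>x\<close>. (When the \<open>H(y)(t)\<close> are probabilities of random faces,
  this keeps each element of the face independently with probability \<open>r\<close>.)
  At a maximal face \<open>y\<close> we have \<open>H(y)(t) = t ^ card y * f y > 0\<close>, so if all \<open>H(y)(t)\<close> are
  nonnegative then all \<open>H(x)(s)\<close> with \<open>0 < s < t\<close> are strictly positive. Hence no root lies
  below \<open>t\<close>, which forces \<open>t = t\<^sub>0\<close> as soon as \<open>t\<close> is itself a root. Conversely, every
  \<open>H(x)\<close> is positive near \<open>0\<close> on the right, hence nonnegative at \<open>t\<^sub>0\<close>. A root exists: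
  otherwise all \<open>H(y)(t)\<close> with \<open>t > 0\<close> are positive, and by the case \<open>r = 0\<close>, \<open>x = {}\<close> of the
  identity they sum to \<open>1\<close>, while \<open>H(y)(t)\<close> is unbounded in \<open>t\<close> for \<open>y\<close> maximal and nonempty.
\<close>

text \<open>The binomial theorem on the Boolean interval from \<open>x\<close> to \<open>z\<close>:
  expanding a product over \<open>z - x\<close>, the chosen subset \<open>w\<close> corresponds to
  \<open>y = w \<union> x\<close>.\<close>

lemma sum_binomial_between:
  fixes a b :: "'b::comm_semiring_1"
  assumes "finite z" "x \<subseteq> z"
  shows "(\<Sum>y | x \<subseteq> y \<and> y \<subseteq> z. a ^ (card y - card x) * b ^ (card z - card y))
    = (a + b) ^ (card z - card x)"
proof -
  have fin: "finite x" "finite (z - x)"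
    using assms finite_subset by auto
  have "(a + b) ^ (card z - card x) = (\<Prod>v\<in>z - x. a + b)"
    using fin assms by (simp add: card_Diff_subset)
  also have "\<dots> = (\<Sum>w\<in>Pow (z - x). a ^ card w * b ^ card (z - x - w))"
    by (subst prod_add[OF fin(2)]) simp
  also have "\<dots> = (\<Sum>y | x \<subseteq> y \<and> y \<subseteq> z. a ^ (card y - card x) * b ^ (card z - card y))"
  proof (rule sum.reindex_bij_witness[of _ "\<lambda>y. y - x" "\<lambda>w. w \<union> x"])
    fix w assume "w \<in> Pow (z - x)"
    then have w: "w \<subseteq> z - x" "finite w" "w \<inter> x = {}"
      using fin(2) finite_subset by auto
    then have "card (w \<union> x) = card w + card x"
      using fin by (simp add: card_Un_disjoint)
    moreover have "z - x - w = z - (w \<union> x)"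
      by auto
    then have "card (z - x - w) = card z - card (w \<union> x)"
      using w fin assms by (simp only:) (rule card_Diff_subset; auto)
    ultimately show "a ^ (card (w \<union> x) - card x) * b ^ (card z - card (w \<union> x))
        = a ^ card w * b ^ card (z - x - w)"
      by simp
  qed (use assms in auto)
  finally show ?thesis ..
qed

section \<open>The thinning identity and positivity below a nonnegative point\<close>

locale positive_weighting =
  fixes \<I> :: "'a set set" and f :: "'a set \<Rightarrow> real"
  assumes finite_faces: "finite \<I>"
    and finite_face: "x \<in> \<I> \<Longrightarrow> finite x"
    and face_subset: "y \<in> \<I> \<Longrightarrow> x \<subseteq> y \<Longrightarrow> x \<in> \<I>"
    and weight_pos: "x \<in> \<I> \<Longrightarrow> 0 < f x"
begin

text \<open>After exchanging the sums, the coefficient of \<open>t ^ card z * f z\<close> is a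
  binomial sum with base \<open>(1 - r) + (- 1) = - r\<close>, exactly as in the expansion of
  \<open>H\<close> at \<open>r * t\<close>.\<close>

lemma H_thinning:
  assumes "x \<in> \<I>"
  shows "H \<I> f x (r * t)
    = (\<Sum>y\<in>{y\<in>\<I>. x \<subseteq> y}. r ^ card x * (1 - r) ^ (card y - card x) * H \<I> f y t)"
proof -
  have "(\<Sum>y\<in>{y\<in>\<I>. x \<subseteq> y}. r ^ card x * (1 - r) ^ (card y - card x) * H \<I> f y t)
    = (\<Sum>y\<in>{y\<in>\<I>. x \<subseteq> y}. \<Sum>z\<in>{z\<in>\<I>. y \<subseteq> z}. r ^ card x * t ^ card z * f z *
         ((1 - r) ^ (card y - card x) * (- 1) ^ (card z - card y)))"
    by (simp add: H_def sum_distrib_left mult_ac)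
  also have "\<dots> = (\<Sum>z\<in>\<I>. \<Sum>y\<in>{y\<in>{y\<in>\<I>. x \<subseteq> y}. y \<subseteq> z}. r ^ card x * t ^ card z * f z *
         ((1 - r) ^ (card y - card x) * (- 1) ^ (card z - card y)))"
    using finite_faces by (intro sum.swap_restrict) auto
  also have "\<dots> = (\<Sum>z\<in>\<I>. if x \<subseteq> z then
      r ^ card x * t ^ card z * f z * (- r) ^ (card z - card x) else 0)"
  proof (rule sum.cong)
    fix z assume z: "z \<in> \<I>"
    have faces: "{y\<in>{y\<in>\<I>. x \<subseteq> y}. y \<subseteq> z} = {y. x \<subseteq> y \<and> y \<subseteq> z}"
      using z face_subset by auto
    show "(\<Sum>y\<in>{y\<in>{y\<in>\<I>. x \<subseteq> y}. y \<subseteq> z}. r ^ card x * t ^ card z * f z *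
         ((1 - r) ^ (card y - card x) * (- 1) ^ (card z - card y)))
      = (if x \<subseteq> z then r ^ card x * t ^ card z * f z * (- r) ^ (card z - card x) else 0)"
    proof (cases "x \<subseteq> z")
      case True
      then show ?thesis
        unfolding faces sum_distrib_left[symmetric]
        by (simp add: sum_binomial_between[OF finite_face[OF z]])
    next
      case False
      then have "{y. x \<subseteq> y \<and> y \<subseteq> z} = {}"
        by auto
      then show ?thesis
        using False unfolding faces by (simp only: sum.empty if_False)
    qed
  qed simp
  also have "\<dots> = (\<Sum>z\<in>{z\<in>\<I>. x \<subseteq> z}. r ^ card x * t ^ card z * f z * (- r) ^ (card z - card x))"
    using finite_faces by (intro sum.inter_filter[symmetric])
  also have "\<dots> = H \<I> f x (r * t)"
    unfolding H_def
  proof (rule sum.cong)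
    fix z assume "z \<in> {z\<in>\<I>. x \<subseteq> z}"
    then have "card x \<le> card z"
      using finite_face by (auto intro: card_mono)
    then have "r ^ card z = r ^ card x * r ^ (card z - card x)"
      by (simp flip: power_add)
    then show "r ^ card x * t ^ card z * f z * (- r) ^ (card z - card x)
      = (- 1) ^ (card z - card x) * (r * t) ^ card z * f z"
      by (simp add: power_mult_distrib power_minus[of r])
  qed simp
  finally show ?thesis ..
qed

lemma H_maximal:
  assumes "x \<in> \<I>" "\<forall>y\<in>\<I>. x \<subseteq> y \<longrightarrow> x = y"
  shows "H \<I> f x t = t ^ card x * f x"
proof -
  have "{y\<in>\<I>. x \<subseteq> y} = {x}"
    using assms by auto
  then show ?thesis
    by (simp add: H_def)
qed

lemma H_pos_below_nonneg:
  assumes "\<forall>y\<in>\<I>. 0 \<le> H \<I> f y t" "0 < s" "s < t" "x \<in> \<I>"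
  shows "0 < H \<I> f x s"
proof -
  obtain m where m: "m \<in> \<I>" "x \<subseteq> m" "\<forall>y\<in>\<I>. m \<subseteq> y \<longrightarrow> m = y"
    using finite_has_maximal2[OF finite_faces assms(4)] by auto
  define r where "r = s / t"
  have r: "0 < r" "r < 1" "s = r * t"
    using assms(2,3) by (auto simp: r_def)
  have "0 < (\<Sum>y\<in>{y\<in>\<I>. x \<subseteq> y}. r ^ card x * (1 - r) ^ (card y - card x) * H \<I> f y t)"
  proof (rule sum_pos2[of _ m])
    show "0 < r ^ card x * (1 - r) ^ (card m - card x) * H \<I> f m t"
      using m r assms(2,3) weight_pos by (simp add: H_maximal)
  qed (use m r assms(1) finite_faces in auto)
  then show ?thesis
    using H_thinning[OF assms(4), of r t] r(3) by simp
qed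

section \<open>Positive zeros through the reduced polynomials\<close>

text \<open>Dividing \<open>H x\<close> by \<open>t ^ card x\<close> removes its spurious zero at \<open>0\<close>.\<close>

definition reduced_H :: "'a set \<Rightarrow> real \<Rightarrow> real" where
  "reduced_H x t = (\<Sum>y\<in>{y\<in>\<I>. x \<subseteq> y}. (- 1) ^ (card y - card x) * t ^ (card y - card x) * f y)"

lemma H_eq_reduced_H: "H \<I> f x t = t ^ card x * reduced_H x t"
  unfolding H_def reduced_H_def sum_distrib_left
proof (rule sum.cong)
  fix y assume "y \<in> {y\<in>\<I>. x \<subseteq> y}"
  then have "card x \<le> card y"
    using finite_face by (auto intro: card_mono)
  then have "t ^ card y = t ^ card x * t ^ (card y - card x)"
    by (simp flip: power_add)
  then show "(- 1) ^ (card y - card x) * t ^ card y * f y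
    = t ^ card x * ((- 1) ^ (card y - card x) * t ^ (card y - card x) * f y)"
    by simp
qed simp

lemma reduced_H_0:
  assumes "x \<in> \<I>"
  shows "reduced_H x 0 = f x"
proof -
  have "reduced_H x 0 = (\<Sum>y\<in>{y\<in>\<I>. x \<subseteq> y}. if y = x then f x else 0)"
    unfolding reduced_H_def
  proof (rule sum.cong)
    fix y assume "y \<in> {y\<in>\<I>. x \<subseteq> y}"
    \<comment> \<open>The exponent of \<open>0\<close> is positive unless \<open>y = x\<close>,
      where \<open>0 ^ 0 = 1\<close> leaves \<open>f x\<close>.\<close>
    then have "card x < card y" if "y \<noteq> x"
      using that finite_face by (auto intro: psubset_card_mono)
    then show "(- 1) ^ (card y - card x) * 0 ^ (card y - card x) * f y = (if y = x then f x else 0)"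
      by auto
  qed simp
  also have "\<dots> = f x"
    using assms finite_faces by simp
  finally show ?thesis .
qed

lemma continuous_on_reduced_H: "continuous_on A (reduced_H x)"
  unfolding reduced_H_def by (intro continuous_intros)

text \<open>Intermediate value theorem: \<open>reduced_H x\<close> starts at \<open>f x > 0\<close>,
  which also excludes \<open>0\<close> as the zero found.\<close>

lemma reduced_H_root_below:
  assumes "x \<in> \<I>" "0 \<le> t" "reduced_H x t \<le> 0"
  obtains s where "0 < s" "s \<le> t" "reduced_H x s = 0"
proof -
  have "\<exists>s\<ge>0. s \<le> t \<and> reduced_H x s = 0"
    using assms reduced_H_0 weight_pos[OF assms(1)]
    by (intro IVT2' continuous_on_reduced_H) auto
  then obtain s where s: "0 \<le> s" "s \<le> t" "reduced_H x s = 0"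
    by auto
  moreover have "s \<noteq> 0"
    using s(3) reduced_H_0[OF assms(1)] weight_pos[OF assms(1)] by auto
  ultimately show ?thesis
    using that[of s] by simp
qed

section \<open>Existence and minimality of the critical root\<close>

definition is_root :: "real \<Rightarrow> bool" where
  "is_root t \<longleftrightarrow> 0 < t \<and> (\<exists>x\<in>\<I>. H \<I> f x t = 0)"

lemma is_root_iff_reduced_H: "is_root t \<longleftrightarrow> 0 < t \<and> (\<exists>x\<in>\<I>. reduced_H x t = 0)"
  by (auto simp: is_root_def H_eq_reduced_H)

lemma ex_root:
  assumes "x \<in> \<I>" "x \<noteq> {}" "f {} = 1"
  shows "\<exists>t. is_root t"
proof (rule ccontr)
  assume no_root: "\<nexists>t. is_root t"
  obtain m where m: "m \<in> \<I>" "x \<subseteq> m" "\<forall>y\<in>\<I>. m \<subseteq> y \<longrightarrow> m = y"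
    using finite_has_maximal2[OF finite_faces assms(1)] by auto
  have fm: "0 < f m"
    using m weight_pos by simp
  \<comment> \<open>Chosen so that \<open>T * f m = f m + 1\<close>, while \<open>T \<ge> 1\<close>
    lets the bound pass to \<open>T ^ card m\<close>.\<close>
  define T where "T = 1 + 1 / f m"
  have T: "1 \<le> T" "1 < T * f m"
    using fm by (auto simp: T_def field_simps)
  have pos: "0 \<le> H \<I> f y T" if y: "y \<in> \<I>" for y
  proof (rule ccontr)
    assume "\<not> 0 \<le> H \<I> f y T"
    then have "reduced_H y T \<le> 0"
      using T by (auto simp: H_eq_reduced_H zero_le_mult_iff)
    then show False
      using reduced_H_root_below[OF y, of T] T no_root y is_root_iff_reduced_H by force
  qed
  have empty: "{} \<in> \<I>"
    using m face_subset by blast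
  have "1 \<le> card m"
    using m assms finite_face[OF m(1)] by (auto simp: Suc_le_eq card_gt_0_iff)
  then have "T \<le> T ^ card m"
    using T(1) self_le_power[of T "card m"] by simp
  then have "1 < T ^ card m * f m"
    using T fm by (meson less_le_trans mult_right_mono less_imp_le)
  also have "\<dots> = H \<I> f m T"
    using m by (simp add: H_maximal)
  also have "\<dots> \<le> (\<Sum>y\<in>\<I>. H \<I> f y T)"
    using m finite_faces pos by (intro member_le_sum) auto
  \<comment> \<open>At \<open>r = 0\<close> and \<open>x = {}\<close> every thinning coefficient is
    \<open>1\<close>, again because \<open>0 ^ 0 = 1\<close>.\<close>
  also have "\<dots> = H \<I> f {} 0"
    using H_thinning[OF empty, of 0 T] by simp
  also have "\<dots> = 1"
    using reduced_H_0[OF empty] assms(3) by (simp add: H_eq_reduced_H)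
  finally show False
    by simp
qed

text \<open>The \<open>LEAST\<close> in \<open>critical_root\<close> is informative only once a
  minimum is known to be attained; compactness provides it.\<close>

lemma ex_least_root:
  assumes "is_root t"
  obtains s where "is_root s" "\<And>s'. is_root s' \<Longrightarrow> s \<le> s'"
proof -
  \<comment> \<open>Since no \<open>reduced_H x\<close> with \<open>x\<close> a face vanishes at
    \<open>0\<close>, the interval can be closed at \<open>0\<close> without adding a false
    root.\<close>
  define S where "S = {0..t} \<inter> (\<Union>x\<in>\<I>. {s. reduced_H x s = 0})"
  have S: "is_root s" if "s \<in> S" for s
    using that reduced_H_0 weight_pos
    by (cases "s = 0") (force simp: S_def is_root_iff_reduced_H)+
  have "compact S"
    unfolding S_def using finite_faces
    by (intro compact_Int_closed compact_Icc closed_UN closed_Collect_eq ballI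
        continuous_on_reduced_H) auto
  moreover have t: "t \<in> S"
    using assms by (auto simp: S_def is_root_iff_reduced_H)
  ultimately obtain s where s: "s \<in> S" "\<forall>s'\<in>S. s \<le> s'"
    using compact_attains_inf[of S] by auto
  show ?thesis
  proof (rule that[of s])
    fix s' assume "is_root s'"
    show "s \<le> s'"
    proof (cases "s' \<le> t")
      case True
      then have "s' \<in> S"
        using \<open>is_root s'\<close> by (auto simp: S_def is_root_iff_reduced_H)
      then show ?thesis
        using s by blast
    next
      case False
      then show ?thesis
        using s t by force
    qed
  qed (use s S in blast)
qed

lemma
  assumes "is_root t"
  shows root_critical_root: "is_root (critical_root \<I> f)"
    and critical_root_le: "is_root s \<Longrightarrow> critical_root \<I> f \<le> s"
proof -
  obtain s\<^sub>0 where s\<^sub>0: "is_root s\<^sub>0" "\<And>s. is_root s \<Longrightarrow> s\<^sub>0 \<le> s"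
    using ex_least_root[OF assms] by metis
  then have "critical_root \<I> f = s\<^sub>0"
    unfolding critical_root_def is_root_def[symmetric] by (rule Least_equality)
  then show "is_root (critical_root \<I> f)" "is_root s \<Longrightarrow> critical_root \<I> f \<le> s"
    using s\<^sub>0 by auto
qed

text \<open>A negative value would yield a root at or below the critical root; minimality makes the
  two equal, so \<open>reduced_H x\<close> would be both zero and negative there.\<close>

lemma H_critical_root_nonneg:
  assumes "is_root t" "x \<in> \<I>"
  shows "0 \<le> H \<I> f x (critical_root \<I> f)"
proof (rule ccontr)
  let ?t = "critical_root \<I> f"
  assume "\<not> 0 \<le> H \<I> f x ?t"
  moreover have t_pos: "0 < ?t"
    using root_critical_root[OF assms(1)] by (simp add: is_root_def)
  ultimately have neg: "reduced_H x ?t < 0"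
    by (auto simp: H_eq_reduced_H zero_le_mult_iff)
  then obtain s where s: "0 < s" "s \<le> ?t" "reduced_H x s = 0"
    using reduced_H_root_below[OF assms(2), of ?t] t_pos by auto
  then have "?t \<le> s"
    using assms by (intro critical_root_le) (auto simp: is_root_iff_reduced_H)
  then show False
    using s neg by auto
qed

text \<open>Minimality gives one inequality; were the critical root below \<open>t\<close>, every
  \<open>H\<close> would be strictly positive at it.\<close>

lemma critical_root_eqI:
  assumes "0 < t" "x \<in> \<I>" "H \<I> f x t = 0" "\<forall>y\<in>\<I>. 0 \<le> H \<I> f y t"
  shows "t = critical_root \<I> f"
proof -
  have t: "is_root t"
    using assms by (auto simp: is_root_def)
  have "is_root (critical_root \<I> f)"
    using t by (rule root_critical_root)
  then have "\<not> critical_root \<I> f < t"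
    using H_pos_below_nonneg[OF assms(4)] by (force simp: is_root_def)
  then show ?thesis
    using critical_root_le[OF t t] by simp
qed

end

theorem theorem3:
  fixes V :: "'a set" and \<I> \<D> :: "'a set set" and f :: "'a set \<Rightarrow> real"
  assumes "weighted_configuration V \<I> \<D> f" and "V \<noteq> {}"
  shows "(type_I \<I> f \<longleftrightarrow>
            (\<exists>t>0. H \<I> f {} t = 0 \<and> (\<forall>x\<in>\<I>. H \<I> f x t \<ge> 0)))
       \<and> ((\<exists>t>0. H \<I> f {} t = 0 \<and> (\<forall>x\<in>\<I>. H \<I> f x t \<ge> 0)) \<longrightarrow>
            (\<exists>!t. t > 0 \<and> H \<I> f {} t = 0 \<and> (\<forall>x\<in>\<I>. H \<I> f x t \<ge> 0)) \<and>
            (\<forall>t>0. H \<I> f {} t = 0 \<and> (\<forall>x\<in>\<I>. H \<I> f x t \<ge> 0) \<longrightarrow> t = critical_root \<I> f))"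
proof -
  have conf: "finite V" "\<I> \<subseteq> Pow V" "\<forall>y\<in>\<I>. \<forall>x. x \<subseteq> y \<longrightarrow> x \<in> \<I>" "\<forall>v\<in>V. {v} \<in> \<I>"
    and f: "\<forall>x\<in>\<I>. f x > 0" "f {} = 1"
    using assms(1) by (auto simp: weighted_configuration_def configuration_def valuation_def)
  interpret positive_weighting \<I> f
  proof
    show "finite \<I>"
      using conf(1,2) by (simp add: finite_subset)
    show "finite x" if "x \<in> \<I>" for x
      using that conf(1,2) by (auto intro: finite_subset)
  qed (use conf f in auto)
  let ?t = "critical_root \<I> f"
  obtain v where "{v} \<in> \<I>"
    using assms(2) conf(4) by blast
  then obtain t where t: "is_root t"
    using ex_root[of "{v}"] f by auto
  have empty: "{} \<in> \<I>"
    using \<open>{v} \<in> \<I>\<close> face_subset by blast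
  have crit: "0 < ?t" "\<forall>x\<in>\<I>. H \<I> f x ?t \<ge> 0"
    using root_critical_root[OF t] H_critical_root_nonneg[OF t] by (auto simp: is_root_def)
  define P where "P s \<longleftrightarrow> s > 0 \<and> H \<I> f {} s = 0 \<and> (\<forall>x\<in>\<I>. H \<I> f x s \<ge> 0)" for s
  have P_eq: "s = ?t" if "P s" for s
    using that empty unfolding P_def by (intro critical_root_eqI) auto
  have P_crit: "P ?t \<longleftrightarrow> type_I \<I> f"
    using crit by (simp add: P_def type_I_def)
  \<comment> \<open>Only \<open>?t\<close> can satisfy \<open>P\<close>, so solvability of
    \<open>P\<close> amounts to \<open>P ?t\<close>, which is type I.\<close>
  have "(type_I \<I> f \<longleftrightarrow> (\<exists>s. P s)) \<and> ((\<exists>s. P s) \<longrightarrow> (\<exists>!s. P s) \<and> (\<forall>s. P s \<longrightarrow> s = ?t))"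
    using P_eq P_crit by blast
  then show ?thesis
    by (simp add: P_def)
qed

end
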